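(* Let $A\colon \mathbb X\to\mathbb Y$ be a bounded linear operator between separable Hilbert spaces, let $((B_\alpha)_{\alpha>0},\alpha^\star)$ be a regularization method for $Ax=y$ over $\mathbb M\subseteq\mathbb X$, and let $(D_{\theta,\beta})_{\theta,\beta}$ be the data-proximal null-space network defined by $U_\theta,V_\theta,\Phi_\beta,A$. Suppose there exist a Lipschitz function $U\colon\mathbb X\to\mathbb X$ and parameter choices $\beta^\star=\beta^\star(\delta,y^\delta)$, $\theta^\star=\theta^\star(\delta,y^\delta)$ such that $(D_{\theta,\beta})_{\theta,\beta}$ are uniformly Lipschitz on bounded sets and $$\forall z\in\mathbb M\colon\quad D_{\theta^\star,\beta^\star}(z)\to(\mathrm{Id}_{\mathbb X}+P_{\mathcal N(A)}U)(z)\quad\text{as }\delta\to0 .$$ Then with $(R_\gamma)_\gamma:=(D_{\theta,\beta}\circ B_\alpha)_{\alpha,\beta,\theta}$ and $\gamma^\star:=(\alpha^\star,\beta^\star,\theta^\star)$, the following hold: 1. $((R_\gamma)_\gamma,\gamma^\star)$ is a convergent regularization method for $Ax=y$ on $(\mathrm{Id}_{\mathbb X}+P_{\mathcal N(A)}U)(\mathbb M)$. 2. If $\beta^\star=\mathcal O(\delta^r)$, then $((R_\gamma)_\gamma,\gamma^\star)$ is rate-$r$ data proximal, provided $((B_\alpha)_\alpha,\alpha^\star)$ is.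
   Context: Notation: $\mathcal N(A)$ and $\mathcal R(A)$ are the null space and range of $A$; $P_{\mathcal N(A)}$ is the orthogonal projection onto $\mathcal N(A)$; $A^+$ is the Moore-Penrose inverse of $A$; $\mathrm{Id}_{\mathbb X}$ is the identity on $\mathbb X$; $\delta>0$ is the noise level and $y^\delta\in\mathbb Y$ denotes noisy data. Regularization method: Let $\Gamma$ be an index set, $\mathbb M\subseteq\mathbb X$, $(R_\gamma)_{\gamma\in\Gamma}$ a family of continuous (possibly non-linear) mappings $R_\gamma\colon\mathbb Y\to\mathbb X$, and $\gamma^\star\colon(0,\infty)\times\mathbb Y\to\Gamma$. The pair $((R_\gamma)_{\gamma\in\Gamma},\gamma^\star)$ is a (convergent) regularization method for $Ax=y$ over $\mathbb M$ if for all $x\in\mathbb M$, $$\lim_{\delta\to0}\Bigl(\sup\{\|x-R_{\gamma^\star(\delta,y^\delta)}(y^\delta)\| : y^\delta\in\mathbb Y,\ \|y^\delta-Ax\|\le\delta\}\Bigr)=0 .$$ For $((B_\alpha)_{\alpha>0},\alpha^\star)$ the index set is $(0,\infty)$. Rate-$r$ data proximity: Let $r\in(0,1]$. A regularization method $((R_\gamma)_{\gamma\in\Gamma},\gamma^\star)$ for $Ax=y$ over $\mathbb M$ is rate-$r$ data proximal if for some $\tau>0$, for all $x\in\mathbb M$ and all $y^\delta\in\mathbb Y$: $\|y^\delta-Ax\|\le\delta$ implies $\|y^\delta-A R_{\gamma^\star(\delta,y^\delta)}(y^\delta)\|\le\tau\delta^r$. Data-proximal null-space network: Let $U_\theta,V_\theta\colon\mathbb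 X\to\mathbb X$ ($\theta\in\Theta$) be Lipschitz mappings, and $\Phi_\beta\colon\mathcal R(A)\to\mathcal R(A)$ ($\beta>0$) mappings with $\|\Phi_\beta(z)\|\le\beta$ for all $\beta>0$, $z\in\mathcal R(A)$. The data-proximal null-space network defined by $U_\theta,V_\theta,\Phi_\beta,A$ is the family of mappings $$D_{\theta,\beta}:=\mathrm{Id}_{\mathbb X}+P_{\mathcal N(A)}\circ U_\theta+A^+\circ\Phi_\beta\circ A\circ V_\theta .$$ *)

theory Defs
  imports "HOL-Analysis.Analysis" "HOL-Library.Landau_Symbols"
begin

text \<open>
  Separable Hilbert spaces are rendered as types of sort
  \<open>{real_inner, complete_space, second_countable_topology}\<close>.
\<close>

definition null_space_of :: "('x::real_vector \<Rightarrow> 'y::real_vector) \<Rightarrow> 'x set" where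
  "null_space_of A = {x. A x = 0}"

definition orth_proj :: "'x::real_inner set \<Rightarrow> 'x \<Rightarrow> 'x" where
  "orth_proj S x = (THE p. p \<in> S \<and> x - p \<in> S\<^sup>\<bottom>)"

text \<open>
  The Moore-Penrose inverse: \<open>A\<^sup>+ y\<close> is the unique least-squares solution of \<open>A x = y\<close>
  (i.e. \<open>y - A x\<close> is orthogonal to the range) that lies in the orthogonal complement of the null
  space.  Its domain is \<open>range A + (range A)\<^sup>\<bottom>\<close>, which need not be the whole space; outside of
  it the value is unspecified.
\<close>
definition pseudo_inverse :: "('x::real_inner \<Rightarrow> 'y::real_inner) \<Rightarrow> 'y \<Rightarrow> 'x" where
  "pseudo_inverse A y = (THE x. x \<in> (null_space_of A)\<^sup>\<bottom> \<and> y - A x \<in> (range A)\<^sup>\<bottom>)"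

text \<open>
  The supremum is taken in the extended reals, since the error may be unbounded for some \<open>\<delta>\<close>.
\<close>
definition regularization_method ::
  "('x::real_normed_vector \<Rightarrow> 'y::real_normed_vector) \<Rightarrow> 'x set \<Rightarrow>
   'g set \<Rightarrow> ('g \<Rightarrow> 'y \<Rightarrow> 'x) \<Rightarrow> (real \<Rightarrow> 'y \<Rightarrow> 'g) \<Rightarrow> bool" where
  "regularization_method A M \<Gamma> R \<gamma> \<longleftrightarrow>
     (\<forall>g\<in>\<Gamma>. continuous_on UNIV (R g)) \<and>
     (\<forall>\<delta>>0. \<forall>y. \<gamma> \<delta> y \<in> \<Gamma>) \<and>
     (\<forall>x\<in>M. ((\<lambda>\<delta>. SUP y\<in>{y. norm (y - A x) \<le> \<delta>}. ereal (norm (x - R (\<gamma> \<delta> y) y)))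
               \<longlongrightarrow> 0) (at_right 0))"

text \<open>The estimate in the definition of data proximity, for noise levels in \<open>I\<close>.\<close>
definition data_proximity_estimate ::
  "real set \<Rightarrow> real \<Rightarrow> ('x::real_normed_vector \<Rightarrow> 'y::real_normed_vector) \<Rightarrow> 'x set \<Rightarrow>
   ('g \<Rightarrow> 'y \<Rightarrow> 'x) \<Rightarrow> (real \<Rightarrow> 'y \<Rightarrow> 'g) \<Rightarrow> bool" where
  "data_proximity_estimate I r A M R \<gamma> \<longleftrightarrow>
     (\<exists>\<tau>>0. \<forall>x\<in>M. \<forall>\<delta>\<in>I. \<forall>y. norm (y - A x) \<le> \<delta> \<longrightarrow>
        norm (y - A (R (\<gamma> \<delta> y) y)) \<le> \<tau> * \<delta> powr r)"

definition rate_data_proximal ::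
  "real \<Rightarrow> ('x::real_normed_vector \<Rightarrow> 'y::real_normed_vector) \<Rightarrow> 'x set \<Rightarrow>
   'g set \<Rightarrow> ('g \<Rightarrow> 'y \<Rightarrow> 'x) \<Rightarrow> (real \<Rightarrow> 'y \<Rightarrow> 'g) \<Rightarrow> bool" where
  "rate_data_proximal r A M \<Gamma> R \<gamma> \<longleftrightarrow>
     0 < r \<and> r \<le> 1 \<and> regularization_method A M \<Gamma> R \<gamma> \<and>
     data_proximity_estimate {0<..} r A M R \<gamma>"

text \<open>The variant that only constrains sufficiently small noise levels.\<close>
definition asymptotically_rate_data_proximal ::
  "real \<Rightarrow> ('x::real_normed_vector \<Rightarrow> 'y::real_normed_vector) \<Rightarrow> 'x set \<Rightarrow>
   'g set \<Rightarrow> ('g \<Rightarrow> 'y \<Rightarrow> 'x) \<Rightarrow> (real \<Rightarrow> 'y \<Rightarrow> 'g) \<Rightarrow> bool" where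
  "asymptotically_rate_data_proximal r A M \<Gamma> R \<gamma> \<longleftrightarrow>
     0 < r \<and> r \<le> 1 \<and> regularization_method A M \<Gamma> R \<gamma> \<and>
     (\<exists>\<delta>\<^sub>0>0. data_proximity_estimate {0<..<\<delta>\<^sub>0} r A M R \<gamma>)"

text \<open>
  The admissible arguments \<open>(\<delta>, y\<^sup>\<delta>)\<close> of a parameter choice.  For a function of both, a bound
  \<open>O(\<delta>\<^sup>r)\<close> along \<open>principal (noisy_data A M)\<close> holds with one constant for all noise levels;
  along \<open>vanishing_noise A M\<close> it holds as \<open>\<delta> \<rightarrow> 0\<close>, uniformly in the noisy data.
\<close>
definition noisy_data ::
  "('x::real_normed_vector \<Rightarrow> 'y::real_normed_vector) \<Rightarrow> 'x set \<Rightarrow> (real \<times> 'y) set" where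
  "noisy_data A M = {(\<delta>, y). 0 < \<delta> \<and> (\<exists>x\<in>M. norm (y - A x) \<le> \<delta>)}"

definition vanishing_noise ::
  "('x::real_normed_vector \<Rightarrow> 'y::real_normed_vector) \<Rightarrow> 'x set \<Rightarrow> (real \<times> 'y) filter" where
  "vanishing_noise A M = inf (filtercomap fst (at_right 0)) (principal (noisy_data A M))"

definition data_proximal_net ::
  "('x::real_inner \<Rightarrow> 'y::real_inner) \<Rightarrow> ('t \<Rightarrow> 'x \<Rightarrow> 'x) \<Rightarrow> ('t \<Rightarrow> 'x \<Rightarrow> 'x) \<Rightarrow>
   (real \<Rightarrow> 'y \<Rightarrow> 'y) \<Rightarrow> 't \<Rightarrow> real \<Rightarrow> 'x \<Rightarrow> 'x" where
  "data_proximal_net A U V \<Phi> \<theta> \<beta> x =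
     x + orth_proj (null_space_of A) (U \<theta> x) + pseudo_inverse A (\<Phi> \<beta> (A (V \<theta> x)))"

definition uniformly_lipschitz_on_bounded_sets ::
  "'i set \<Rightarrow> ('i \<Rightarrow> 'a::metric_space \<Rightarrow> 'b::metric_space) \<Rightarrow> bool" where
  "uniformly_lipschitz_on_bounded_sets I F \<longleftrightarrow>
     (\<forall>S. bounded S \<longrightarrow> (\<exists>L. \<forall>i\<in>I. L-lipschitz_on S (F i)))"

end

theory Submission
  imports Defs
begin

text \<open>
  Since \<open>P\<^bsub>N(A)\<^esub>\<close> maps into the kernel of \<open>A\<close> and \<open>A\<close> inverts its Moore-Penrose inverse on the range,
  the network changes the data only by the bounded term \<open>\<Phi>\<^sub>\<beta>\<close>, that is
  \<open>A (D x) = A x + \<Phi>\<^sub>\<beta> (A (V x))\<close>; this gives the data proximity.  For the convergence, the error is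
  split into \<open>T x - D x\<close> and \<open>D x - D (B y)\<close>.  The second term is controlled by the uniform Lipschitz
  constant on a ball around \<open>x\<close>, the first one by the assumed convergence, which is automatically
  uniform in the noisy data because it holds for every selection \<open>\<delta> \<mapsto> y\<^sup>\<delta>\<close>.
\<close>

section \<open>Orthogonal projection in Hilbert spaces\<close>

text \<open>By convexity the midpoint of \<open>a\<close> and \<open>b\<close> is no better than the
  lower bound \<open>d\<close>, so the parallelogram law for \<open>x - a\<close> and
  \<open>x - b\<close> leaves at most \<open>4 * e\<close> for the squared distance of
  \<open>a\<close> and \<open>b\<close>. This is the Cauchy-type estimate behind closest
  points.\<close>

lemma norm_diff_le_near_min_dist:
  fixes S :: "'a::real_inner set"
  assumes S: "convex S" and a: "a \<in> S" and b: "b \<in> S"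
    and d: "\<And>q. q \<in> S \<Longrightarrow> d \<le> (norm (x - q))\<^sup>2"
    and le: "(norm (x - a))\<^sup>2 \<le> d + e" "(norm (x - b))\<^sup>2 \<le> d + e"
  shows "(norm (a - b))\<^sup>2 \<le> 4 * e"
proof -
  define m where "m = (1/2) *\<^sub>R a + (1/2) *\<^sub>R b"
  have "m \<in> S"
    unfolding m_def using S a b by (rule convexD) auto
  then have "d \<le> (norm (x - m))\<^sup>2"
    by (rule d)
  moreover have "a + b = 2 *\<^sub>R m"
    by (simp add: m_def scaleR_add_right)
  then have "(x - a) + (x - b) = 2 *\<^sub>R (x - m)"
    by (simp add: scaleR_diff_right scaleR_2 algebra_simps)
  then have "(norm ((x - a) + (x - b)))\<^sup>2 = 4 * (norm (x - m))\<^sup>2"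
    by (simp add: power_mult_distrib)
  moreover have "(norm (u + v))\<^sup>2 + (norm (u - v))\<^sup>2 = 2 * (norm u)\<^sup>2 + 2 * (norm v)\<^sup>2"
    for u v :: 'a
    by (simp add: power2_norm_eq_inner inner_add_left inner_add_right
        inner_diff_left inner_diff_right inner_commute)
  from this[of "x - a" "x - b"]
  have "(norm ((x - a) + (x - b)))\<^sup>2 + (norm (a - b))\<^sup>2
      = 2 * (norm (x - a))\<^sup>2 + 2 * (norm (x - b))\<^sup>2"
    by (simp add: norm_minus_commute)
  ultimately show ?thesis using le by linarith
qed

text \<open>Completeness replaces compactness: the sets \<open>F n\<close> of near-minimisers are
  closed, nonempty and decreasing, and their diameters shrink to 0 by the previous lemma. By
  Cantor's intersection theorem they have a common point, which attains the infimum.\<close>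

lemma closest_point_exists_complete:
  fixes S :: "'a::{real_inner,complete_space} set"
  assumes "closed S" "convex S" "S \<noteq> {}"
  shows "\<exists>p\<in>S. \<forall>q\<in>S. dist x p \<le> dist x q"
proof -
  define d where "d = (INF q\<in>S. (norm (x - q))\<^sup>2)"
  have bdd: "bdd_below ((\<lambda>q. (norm (x - q))\<^sup>2) ` S)"
    by (rule bdd_belowI2[of _ 0]) simp
  have d: "d \<le> (norm (x - q))\<^sup>2" if "q \<in> S" for q
    unfolding d_def using bdd that by (rule cINF_lower)
  define F where "F n = {p \<in> S. (norm (x - p))\<^sup>2 \<le> d + 1 / real (Suc n)}" for n
  obtain p where p: "\<And>n. p \<in> F n"
  proof (rule decreasing_closed_nest)
    fix n
    have "F n = S \<inter> {p. (norm (x - p))\<^sup>2 \<le> d + 1 / real (Suc n)}"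
      by (auto simp: F_def)
    then show "closed (F n)"
      using \<open>closed S\<close> by (auto intro!: closed_Int closed_Collect_le continuous_intros)
    have "d < d + 1 / real (Suc n)" by simp
    then obtain p where "p \<in> S" "(norm (x - p))\<^sup>2 < d + 1 / real (Suc n)"
      unfolding d_def using cINF_less_iff[OF \<open>S \<noteq> {}\<close> bdd] by blast
    then show "F n \<noteq> {}"
      by (force simp: F_def)
  next
    fix m n :: nat
    assume "m \<le> n"
    then have "1 / real (Suc n) \<le> 1 / real (Suc m)"
      by (simp add: frac_le)
    then show "F n \<subseteq> F m"
      by (auto simp: F_def)
  next
    fix e :: real
    assume "e > 0"
    \<comment> \<open>The previous lemma bounds squared distances within \<open>F n\<close> by four
      times the excess over the infimum, hence the quarter of \<open>e\<^sup>2\<close>.\<close>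
    then obtain n where n: "1 / real (Suc n) < e\<^sup>2 / 4"
      using nat_approx_posE[of "e\<^sup>2 / 4"] by auto
    have "dist p q < e" if "p \<in> F n" "q \<in> F n" for p q
    proof -
      have "(norm (p - q))\<^sup>2 \<le> 4 * (1 / real (Suc n))"
        using that d by (intro norm_diff_le_near_min_dist[OF \<open>convex S\<close>]) (auto simp: F_def)
      also have "\<dots> < e\<^sup>2" using n by simp
      finally show ?thesis
        using \<open>e > 0\<close> by (simp add: dist_norm power2_less_imp_less)
    qed
    then show "\<exists>n. \<forall>p\<in>F n. \<forall>q\<in>F n. dist p q < e" by blast
  qed auto
  have "(norm (x - p))\<^sup>2 \<le> d"
  proof (rule field_le_epsilon)
    fix e :: real
    assume "e > 0"
    then obtain n where "1 / real (Suc n) < e"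
      using nat_approx_posE by blast
    then show "(norm (x - p))\<^sup>2 \<le> d + e"
      using p[of n] by (simp add: F_def)
  qed
  then have "dist x p \<le> dist x q" if "q \<in> S" for q
    unfolding dist_norm using d[OF that] by (rule power2_le_imp_le[OF order_trans]) simp
  moreover have "p \<in> S" using p[of 0] by (simp add: F_def)
  ultimately show ?thesis by blast
qed

text \<open>The closest point \<open>p\<close> makes \<open>x - p\<close> form a non-acute angle
  with every direction leading from \<open>p\<close> into \<open>S\<close>. In a subspace both
  \<open>v\<close> and \<open>- v\<close> are such directions, which forces orthogonality.\<close>

lemma orthogonal_decomposition_exists:
  fixes S :: "'a::{real_inner,complete_space} set"
  assumes "closed S" "subspace S"
  obtains p where "p \<in> S" "x - p \<in> S\<^sup>\<bottom>"
proof -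
  have "convex S" "S \<noteq> {}"
    using assms subspace_imp_convex subspace_0 by auto
  obtain p where p: "p \<in> S" "\<forall>q\<in>S. dist x p \<le> dist x q"
    using closest_point_exists_complete[OF \<open>closed S\<close> \<open>convex S\<close> \<open>S \<noteq> {}\<close>] by blast
  have le: "inner (x - p) v \<le> 0" if "v \<in> S" for v
    using any_closest_point_dot[OF \<open>convex S\<close> \<open>closed S\<close> \<open>p \<in> S\<close>, of "p + v" x] p that assms
    by (simp add: subspace_add)
  have "inner (x - p) v = 0" if "v \<in> S" for v
    using le[OF that] le[of "- v"] that assms by (simp add: subspace_neg)
  then have "x - p \<in> S\<^sup>\<bottom>"
    by (auto simp: orthogonal_comp_def orthogonal_def inner_commute)
  then show thesis using that p by blast
qed

lemma orthogonal_comp_Int_eq_0: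
  assumes "x \<in> S" "x \<in> S\<^sup>\<bottom>"
  shows "x = 0"
  using assms by (auto simp: orthogonal_comp_def orthogonal_def)

lemma orth_proj_props:
  fixes S :: "'a::{real_inner,complete_space} set"
  assumes "closed S" "subspace S"
  shows "orth_proj S x \<in> S" "x - orth_proj S x \<in> S\<^sup>\<bottom>"
proof -
  obtain p where p: "p \<in> S" "x - p \<in> S\<^sup>\<bottom>"
    by (rule orthogonal_decomposition_exists[OF assms])
  have unique: "q = p" if "q \<in> S \<and> x - q \<in> S\<^sup>\<bottom>" for q
  proof -
    have "q - p \<in> S" using that p assms by (simp add: subspace_diff)
    moreover have "q - p \<in> S\<^sup>\<bottom>"
      \<comment> \<open>\<open>q - p\<close> is the difference of the two residuals
        \<open>x - p\<close> and \<open>x - q\<close>.\<close>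
      using that p subspace_diff[OF subspace_orthogonal_comp, of "x - p" S "x - q"] by simp
    ultimately have "q - p = 0"
      by (rule orthogonal_comp_Int_eq_0)
    then show ?thesis by simp
  qed
  have "\<exists>!p. p \<in> S \<and> x - p \<in> S\<^sup>\<bottom>"
    by (rule ex1I[OF _ unique]) (use p in simp)
  from theI'[OF this] show "orth_proj S x \<in> S" "x - orth_proj S x \<in> S\<^sup>\<bottom>"
    by (simp_all add: orth_proj_def)
qed

section \<open>Null space and Moore-Penrose inverse\<close>

lemma closed_subspace_null_space:
  assumes "bounded_linear A"
  shows "closed (null_space_of A)" "subspace (null_space_of A)"
proof -
  interpret A: bounded_linear A by fact
  show "closed (null_space_of A)"
    unfolding null_space_of_def
    by (intro closed_Collect_eq A.continuous_on continuous_intros)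
  show "subspace (null_space_of A)"
    by (auto simp: subspace_def null_space_of_def A.add A.scaleR A.zero)
qed

lemma bounded_linear_orth_proj_null_space:
  fixes A :: "'x::{real_inner,complete_space} \<Rightarrow> 'y::real_normed_vector"
  assumes "bounded_linear A"
  shows "A (orth_proj (null_space_of A) x) = 0"
  using orth_proj_props(1)[OF closed_subspace_null_space[OF assms], of x]
  by (simp add: null_space_of_def)

text \<open>The range need not be closed, but for \<open>y\<close> in the range a least-squares
  solution has its residual both in the range and in the orthogonal complement, so it solves the
  equation exactly.\<close>

lemma bounded_linear_pseudo_inverse:
  fixes A :: "'x::{real_inner,complete_space} \<Rightarrow> 'y::real_inner"
  assumes A: "bounded_linear A" and y: "y \<in> range A"
  shows "A (pseudo_inverse A y) = y"
proof -
  interpret A: bounded_linear A by fact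
  let ?N = "null_space_of A"
  have range: "A u \<in> range A" for u by simp
  have sub: "subspace (range A)"
    by (simp add: A.linear_axioms linear_subspace_image)
  obtain z where z: "y = A z" using y by auto
  \<comment> \<open>Removing the null space component from a preimage keeps its image and moves it
    into the orthogonal complement of the null space.\<close>
  define x where "x = z - orth_proj ?N z"
  have x: "x \<in> ?N\<^sup>\<bottom>" "A x = y"
    using orth_proj_props(2)[OF closed_subspace_null_space[OF A], of z]
    by (auto simp: x_def z A.diff bounded_linear_orth_proj_null_space[OF A])
  have "u = x" if u: "u \<in> ?N\<^sup>\<bottom> \<and> y - A u \<in> (range A)\<^sup>\<bottom>" for u
  proof -
    have "y - A u \<in> range A"
      using subspace_diff[OF sub range range, of x u] x by simp
    then have "y - A u = 0"
      by (rule orthogonal_comp_Int_eq_0) (simp add: u)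
    then have "u - x \<in> ?N" using x by (simp add: null_space_of_def A.diff)
    moreover have "u - x \<in> ?N\<^sup>\<bottom>"
      using u x by (intro subspace_diff subspace_orthogonal_comp) auto
    ultimately have "u - x = 0"
      by (rule orthogonal_comp_Int_eq_0)
    then show ?thesis by simp
  qed
  moreover have "x \<in> ?N\<^sup>\<bottom> \<and> y - A x \<in> (range A)\<^sup>\<bottom>"
    using x by (simp add: subspace_0 subspace_orthogonal_comp)
  ultimately have "pseudo_inverse A y = x"
    unfolding pseudo_inverse_def by (rule the_equality[rotated])
  with x show ?thesis by simp
qed

text \<open>Membership in the range is assumed because off the range \<open>pseudo_inverse\<close>
  need not be a right inverse of \<open>A\<close>.\<close>

lemma bounded_linear_data_proximal_net:
  fixes A :: "'x::{real_inner,complete_space} \<Rightarrow> 'y::real_inner"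
  assumes A: "bounded_linear A" and "\<Phi> \<beta> (A (V \<theta> x)) \<in> range A"
  shows "A (data_proximal_net A U V \<Phi> \<theta> \<beta> x) = A x + \<Phi> \<beta> (A (V \<theta> x))"
proof -
  interpret A: bounded_linear A by fact
  show ?thesis
    using bounded_linear_pseudo_inverse[OF assms]
    by (simp add: data_proximal_net_def A.add bounded_linear_orth_proj_null_space[OF A])
qed

section \<open>Convergence of regularization methods\<close>

text \<open>This trades the supremum in the extended reals for a bound that is uniform in the noisy
  data and can be combined with the triangle inequality.\<close>

lemma tendsto_SUP_norm_iff:
  fixes f :: "real \<Rightarrow> 'y::real_normed_vector \<Rightarrow> 'x::real_normed_vector"
  shows "((\<lambda>\<delta>. SUP y\<in>{y. norm (y - a) \<le> \<delta>}. ereal (norm (f \<delta> y))) \<longlongrightarrow> 0) (at_right 0) \<longleftrightarrow>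
    (\<forall>\<epsilon>>0. \<forall>\<^sub>F \<delta> in at_right 0. \<forall>y. norm (y - a) \<le> \<delta> \<longrightarrow> norm (f \<delta> y) \<le> \<epsilon>)"
    (is "(?S \<longlongrightarrow> 0) _ \<longleftrightarrow> ?R")
proof
  assume L: "(?S \<longlongrightarrow> 0) (at_right 0)"
  show ?R
  proof (intro allI impI)
    fix \<epsilon> :: real assume "\<epsilon> > 0"
    then have "\<forall>\<^sub>F \<delta> in at_right 0. ?S \<delta> < ereal \<epsilon>"
      by (intro order_tendstoD(2)[OF L]) auto
    then show "\<forall>\<^sub>F \<delta> in at_right 0. \<forall>y. norm (y - a) \<le> \<delta> \<longrightarrow> norm (f \<delta> y) \<le> \<epsilon>"
    proof eventually_elim
      case (elim \<delta>)
      show ?case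
      proof (intro allI impI)
        fix y assume "norm (y - a) \<le> \<delta>"
        then have "ereal (norm (f \<delta> y)) \<le> ?S \<delta>" by (intro SUP_upper) simp
        with elim have "ereal (norm (f \<delta> y)) < ereal \<epsilon>" by (rule le_less_trans[rotated])
        then show "norm (f \<delta> y) \<le> \<epsilon>" by simp
      qed
    qed
  qed
next
  assume R: ?R
  show "(?S \<longlongrightarrow> 0) (at_right 0)"
  proof (rule order_tendstoI)
    fix c :: ereal assume "c < 0"
    \<comment> \<open>For positive noise levels the exact data \<open>a\<close> are admissible, so
      the supremum ranges over a nonempty set and is nonnegative.\<close>
    have "\<forall>\<^sub>F \<delta>::real in at_right 0. 0 < \<delta>" by (rule eventually_at_right_less)
    then show "\<forall>\<^sub>F \<delta> in at_right 0. c < ?S \<delta>"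
    proof eventually_elim
      case (elim \<delta>)
      have "0 \<le> ereal (norm (f \<delta> a))" by simp
      also have "\<dots> \<le> ?S \<delta>" using elim by (intro SUP_upper) simp
      finally show ?case using \<open>c < 0\<close> by (rule less_le_trans[rotated])
    qed
  next
    fix c :: ereal assume "0 < c"
    \<comment> \<open>A real number strictly below \<open>c\<close> is inserted because
      \<open>c\<close> may be infinite and a supremum inherits only the non-strict bound.\<close>
    then obtain \<epsilon> where \<epsilon>: "0 < ereal \<epsilon>" "ereal \<epsilon> < c"
      using ereal_dense2 by blast
    then have "\<forall>\<^sub>F \<delta> in at_right 0. \<forall>y. norm (y - a) \<le> \<delta> \<longrightarrow> norm (f \<delta> y) \<le> \<epsilon>"
      using R by simp
    then show "\<forall>\<^sub>F \<delta> in at_right 0. ?S \<delta> < c"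
    proof eventually_elim
      case (elim \<delta>)
      have "?S \<delta> \<le> ereal \<epsilon>" using elim by (intro SUP_least) simp
      then show ?case using \<epsilon>(2) by (rule le_less_trans)
    qed
  qed
qed

text \<open>By choice, a single selection \<open>w\<close> picks violating data at every noise level
  that has any. Convergence along \<open>w\<close> then excludes violations at all small noise
  levels.\<close>

lemma eventually_uniform_if_selections:
  fixes F :: "real \<Rightarrow> 'y::real_normed_vector \<Rightarrow> 'x::real_normed_vector"
  assumes sel: "\<And>y. (\<And>\<delta>. \<delta> > 0 \<Longrightarrow> norm (y \<delta> - a) \<le> \<delta>) \<Longrightarrow>
      ((\<lambda>\<delta>. F \<delta> (y \<delta>)) \<longlongrightarrow> l) (at_right 0)"
    and "\<epsilon> > 0"
  shows "\<forall>\<^sub>F \<delta> in at_right 0. \<forall>y. norm (y - a) \<le> \<delta> \<longrightarrow> norm (l - F \<delta> y) \<le> \<epsilon>"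
proof -
  define bad where "bad \<delta> y \<longleftrightarrow> norm (y - a) \<le> \<delta> \<and> norm (l - F \<delta> y) > \<epsilon>" for \<delta> y
  \<comment> \<open>The default \<open>a\<close> keeps \<open>w\<close> admissible at the levels
    without violations.\<close>
  define w where "w \<delta> = (if \<exists>y. bad \<delta> y then SOME y. bad \<delta> y else a)" for \<delta>
  have w: "bad \<delta> (w \<delta>)" if "bad \<delta> y" for \<delta> y
    using that unfolding w_def by (auto intro: someI)
  have "norm (w \<delta> - a) \<le> \<delta>" if "\<delta> > 0" for \<delta>
    using that w[of \<delta>] by (cases "\<exists>y. bad \<delta> y") (auto simp: bad_def w_def)
  then have "\<forall>\<^sub>F \<delta> in at_right 0. dist (F \<delta> (w \<delta>)) l < \<epsilon>"
    using sel \<open>\<epsilon> > 0\<close> by (intro tendstoD) auto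
  then show ?thesis
  proof eventually_elim
    case (elim \<delta>)
    then have "\<not> bad \<delta> (w \<delta>)"
      by (simp add: bad_def dist_norm norm_minus_commute)
    then have "\<not> bad \<delta> y" for y using w by blast
    then show ?case by (auto simp: bad_def not_less)
  qed
qed

text \<open>Continuity is local, so the Lipschitz bound on the open unit ball around each point
  suffices.\<close>

lemma uniformly_lipschitz_continuous_on:
  fixes F :: "'i \<Rightarrow> 'a::metric_space \<Rightarrow> 'b::metric_space"
  assumes "uniformly_lipschitz_on_bounded_sets I F" "i \<in> I"
  shows "continuous_on UNIV (F i)"
proof -
  have "isCont (F i) x" for x
  proof -
    obtain L where "L-lipschitz_on (ball x 1) (F i)"
      using assms bounded_ball unfolding uniformly_lipschitz_on_bounded_sets_def by blast
    then have "continuous_on (ball x 1) (F i)"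
      by (rule lipschitz_on_continuous_on)
    then show ?thesis by (simp add: continuous_on_eq_continuous_at)
  qed
  then show ?thesis by (simp add: continuous_on_eq_continuous_at)
qed

text \<open>Since \<open>T\<close> preserves exact data, a point and its image under
  \<open>T\<close> admit the same noisy data. The triangle inequality then adds the constants. The
  smaller set \<open>J\<close> of noise levels serves the asymptotic variant.\<close>

lemma data_proximity_estimate_perturb:
  assumes "data_proximity_estimate I r A M R \<gamma>" and "C > 0"
    and AT: "\<And>x. A (T x) = A x"
    and close: "\<And>x \<delta> y. x \<in> M \<Longrightarrow> \<delta> \<in> J \<Longrightarrow> norm (y - A x) \<le> \<delta> \<Longrightarrow>
      norm (A (R' (\<gamma>' \<delta> y) y) - A (R (\<gamma> \<delta> y) y)) \<le> C * \<delta> powr r"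
    and "J \<subseteq> I"
  shows "data_proximity_estimate J r A (T ` M) R' \<gamma>'"
proof -
  obtain \<tau> where "\<tau> > 0" and \<tau>: "\<And>x \<delta> y. x \<in> M \<Longrightarrow> \<delta> \<in> I \<Longrightarrow> norm (y - A x) \<le> \<delta> \<Longrightarrow>
      norm (y - A (R (\<gamma> \<delta> y) y)) \<le> \<tau> * \<delta> powr r"
    using assms(1) unfolding data_proximity_estimate_def by blast
  have "norm (y - A (R' (\<gamma>' \<delta> y) y)) \<le> (\<tau> + C) * \<delta> powr r"
    if "x \<in> M" "\<delta> \<in> J" "norm (y - A x) \<le> \<delta>" for x \<delta> y
  proof -
    have "norm (y - A (R' (\<gamma>' \<delta> y) y)) \<le>
        norm (y - A (R (\<gamma> \<delta> y) y)) + norm (A (R' (\<gamma>' \<delta> y) y) - A (R (\<gamma> \<delta> y) y))"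
      using norm_triangle_ineq4[of "y - A (R (\<gamma> \<delta> y) y)" "A (R' (\<gamma>' \<delta> y) y) - A (R (\<gamma> \<delta> y) y)"]
      by (simp add: algebra_simps)
    also have "\<dots> \<le> \<tau> * \<delta> powr r + C * \<delta> powr r"
      using \<tau> close that \<open>J \<subseteq> I\<close> by (intro add_mono) auto
    finally show ?thesis by (simp add: algebra_simps)
  qed
  then show ?thesis
    unfolding data_proximity_estimate_def
    using \<open>\<tau> > 0\<close> \<open>C > 0\<close> by (intro exI[of _ "\<tau> + C"]) (auto simp: AT)
qed

text \<open>The rate claim appears for both readings of the condition on \<open>\<beta>s\<close>:
  one constant for all noise levels, or a bound as the noise vanishes. Each is paired with the
  matching notion of data proximity. As the parameter choices depend on the data,
  \<open>D_conv\<close> ranges over arbitrary selections of noisy data.\<close>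

theorem theorem2p8:
  fixes A :: "'x::{real_inner,complete_space,second_countable_topology}
              \<Rightarrow> 'y::{real_inner,complete_space,second_countable_topology}"
    and M :: "'x set"
    and B :: "real \<Rightarrow> 'y \<Rightarrow> 'x" and \<alpha>s :: "real \<Rightarrow> 'y \<Rightarrow> real"
    and \<Theta> :: "'t set"
    and U\<^sub>\<theta> V\<^sub>\<theta> :: "'t \<Rightarrow> 'x \<Rightarrow> 'x" and \<Phi> :: "real \<Rightarrow> 'y \<Rightarrow> 'y"
    and U :: "'x \<Rightarrow> 'x"
    and \<beta>s :: "real \<Rightarrow> 'y \<Rightarrow> real" and \<theta>s :: "real \<Rightarrow> 'y \<Rightarrow> 't"
    and D :: "'t \<Rightarrow> real \<Rightarrow> 'x \<Rightarrow> 'x" and T :: "'x \<Rightarrow> 'x"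
    and \<Gamma> :: "(real \<times> real \<times> 't) set" and R :: "real \<times> real \<times> 't \<Rightarrow> 'y \<Rightarrow> 'x"
    and \<gamma>s :: "real \<Rightarrow> 'y \<Rightarrow> real \<times> real \<times> 't"
  assumes D: "D = data_proximal_net A U\<^sub>\<theta> V\<^sub>\<theta> \<Phi>"
    and T: "T = (\<lambda>x. x + orth_proj (null_space_of A) (U x))"
    and \<Gamma>: "\<Gamma> = {0<..} \<times> {0<..} \<times> \<Theta>"
    and R: "R = (\<lambda>(\<alpha>, \<beta>, \<theta>). D \<theta> \<beta> \<circ> B \<alpha>)"
    and \<gamma>s: "\<gamma>s = (\<lambda>\<delta> y. (\<alpha>s \<delta> y, \<beta>s \<delta> y, \<theta>s \<delta> y))"
    and A: "bounded_linear A"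
    and B: "regularization_method A M {0<..} B \<alpha>s"
    and U\<^sub>\<theta>: "\<And>\<theta>. \<theta> \<in> \<Theta> \<Longrightarrow> \<exists>L. L-lipschitz_on UNIV (U\<^sub>\<theta> \<theta>)"
    and V\<^sub>\<theta>: "\<And>\<theta>. \<theta> \<in> \<Theta> \<Longrightarrow> \<exists>L. L-lipschitz_on UNIV (V\<^sub>\<theta> \<theta>)"
    and \<Phi>_range: "\<And>\<beta> z. \<beta> > 0 \<Longrightarrow> z \<in> range A \<Longrightarrow> \<Phi> \<beta> z \<in> range A"
    and \<Phi>_bound: "\<And>\<beta> z. \<beta> > 0 \<Longrightarrow> z \<in> range A \<Longrightarrow> norm (\<Phi> \<beta> z) \<le> \<beta>"
    and U: "\<exists>L. L-lipschitz_on UNIV U"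
    and \<beta>s: "\<And>\<delta> y. \<delta> > 0 \<Longrightarrow> \<beta>s \<delta> y > 0"
    and \<theta>s: "\<And>\<delta> y. \<delta> > 0 \<Longrightarrow> \<theta>s \<delta> y \<in> \<Theta>"
    and D_lipschitz: "uniformly_lipschitz_on_bounded_sets (\<Theta> \<times> {0<..}) (\<lambda>(\<theta>, \<beta>). D \<theta> \<beta>)"
    and D_conv: "\<And>z (y :: real \<Rightarrow> 'y). z \<in> M \<Longrightarrow> (\<And>\<delta>. \<delta> > 0 \<Longrightarrow> norm (y \<delta> - A z) \<le> \<delta>) \<Longrightarrow>
           ((\<lambda>\<delta>. D (\<theta>s \<delta> (y \<delta>)) (\<beta>s \<delta> (y \<delta>)) z) \<longlongrightarrow> T z) (at_right 0)"
  shows "regularization_method A (T ` M) \<Gamma> R \<gamma>s \<and>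
    (\<forall>r. 0 < r \<and> r \<le> 1 \<longrightarrow>
      (\<lambda>(\<delta>, y). \<beta>s \<delta> y) \<in> O[principal (noisy_data A M)](\<lambda>(\<delta>, y). \<delta> powr r) \<longrightarrow>
      rate_data_proximal r A M {0<..} B \<alpha>s \<longrightarrow>
      rate_data_proximal r A (T ` M) \<Gamma> R \<gamma>s) \<and>
    (\<forall>r. 0 < r \<and> r \<le> 1 \<longrightarrow>
      (\<lambda>(\<delta>, y). \<beta>s \<delta> y) \<in> O[vanishing_noise A M](\<lambda>(\<delta>, y). \<delta> powr r) \<longrightarrow>
      asymptotically_rate_data_proximal r A M {0<..} B \<alpha>s \<longrightarrow>
      asymptotically_rate_data_proximal r A (T ` M) \<Gamma> R \<gamma>s)"
proof -
  have AT: "A (T x) = A x" for x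
    using A by (simp add: T bounded_linear_orth_proj_null_space linear_simps)
  \<comment> \<open>The difference is the value of \<Phi> at a point of the range, which is bounded
    by its parameter.\<close>
  have AD: "norm (A (R (\<gamma>s \<delta> y) y) - A (B (\<alpha>s \<delta> y) y)) \<le> \<beta>s \<delta> y" if "\<delta> > 0" for \<delta> y
    using \<Phi>_range \<Phi>_bound \<beta>s[OF that] by (simp add: R \<gamma>s D bounded_linear_data_proximal_net[OF A])
  have reg: "regularization_method A (T ` M) \<Gamma> R \<gamma>s"
    unfolding regularization_method_def
  proof (intro conjI ballI allI impI)
    fix g assume "g \<in> \<Gamma>"
    then obtain \<alpha> \<beta> \<theta> where g: "g = (\<alpha>, \<beta>, \<theta>)" "\<alpha> > 0" "\<beta> > 0" "\<theta> \<in> \<Theta>"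
      by (auto simp: \<Gamma>)
    have "continuous_on UNIV (D \<theta> \<beta>)"
      using uniformly_lipschitz_continuous_on[OF D_lipschitz, of "(\<theta>, \<beta>)"] g by simp
    moreover have "continuous_on UNIV (B \<alpha>)"
      using B g by (simp add: regularization_method_def)
    ultimately have "continuous_on UNIV (D \<theta> \<beta> \<circ> B \<alpha>)"
      by (blast intro: continuous_on_compose continuous_on_subset)
    then show "continuous_on UNIV (R g)"
      by (simp add: R g)
  next
    fix \<delta> :: real and y assume "\<delta> > 0"
    then show "\<gamma>s \<delta> y \<in> \<Gamma>"
      using B \<beta>s \<theta>s by (auto simp: \<gamma>s \<Gamma> regularization_method_def)
  next
    fix x' assume "x' \<in> T ` M"
    then obtain x where x: "x \<in> M" "x' = T x" by blast
    have "((\<lambda>\<delta>. SUP y\<in>{y. norm (y - A x) \<le> \<delta>}. ereal (norm (x - B (\<alpha>s \<delta> y) y))) \<longlongrightarrow> 0) (at_right 0)"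
      using B x by (simp add: regularization_method_def)
    then have Bx: "\<forall>\<^sub>F \<delta> in at_right 0. \<forall>y. norm (y - A x) \<le> \<delta> \<longrightarrow> norm (x - B (\<alpha>s \<delta> y) y) \<le> \<epsilon>"
      if "\<epsilon> > 0" for \<epsilon>
      using that unfolding tendsto_SUP_norm_iff by blast
    obtain L where L: "\<And>\<theta> \<beta>. \<theta> \<in> \<Theta> \<Longrightarrow> \<beta> > 0 \<Longrightarrow> L-lipschitz_on (cball x 1) (D \<theta> \<beta>)"
      using D_lipschitz bounded_cball[of x 1] unfolding uniformly_lipschitz_on_bounded_sets_def
      by fastforce
    \<comment> \<open>Because \<open>x\<close> and \<open>T x\<close> have the same exact data, the
      supremum can be taken around \<open>A x\<close>, where the convergence of \<open>B\<close>
      applies.\<close>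
    have "((\<lambda>\<delta>. SUP y\<in>{y. norm (y - A x) \<le> \<delta>}. ereal (norm (T x - R (\<gamma>s \<delta> y) y))) \<longlongrightarrow> 0) (at_right 0)"
      unfolding tendsto_SUP_norm_iff
    proof (intro allI impI)
      fix \<epsilon> :: real assume "\<epsilon> > 0"
      \<comment> \<open>The bound 1 keeps the reconstruction by \<open>B\<close> in the ball on
        which \<open>L\<close> is valid; the other bound makes the Lipschitz term at most half of
        \<epsilon>. The denominator \<open>\<bar>L\<bar> + 1\<close> is positive whatever
        \<open>L\<close> is.\<close>
      define \<eta> where "\<eta> = min 1 (\<epsilon> / 2 / (\<bar>L\<bar> + 1))"
      have "\<eta> > 0" "\<eta> \<le> 1" using \<open>\<epsilon> > 0\<close> by (auto simp: \<eta>_def)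
      have "\<eta> \<le> \<epsilon> / 2 / (\<bar>L\<bar> + 1)" by (simp add: \<eta>_def)
      then have L\<eta>: "(\<bar>L\<bar> + 1) * \<eta> \<le> \<epsilon> / 2"
        by (simp add: pos_le_divide_eq algebra_simps)
      have "\<forall>\<^sub>F \<delta> in at_right 0. \<forall>y. norm (y - A x) \<le> \<delta> \<longrightarrow>
          norm (T x - D (\<theta>s \<delta> y) (\<beta>s \<delta> y) x) \<le> \<epsilon> / 2"
        using D_conv[OF \<open>x \<in> M\<close>] \<open>\<epsilon> > 0\<close> by (intro eventually_uniform_if_selections) auto
      moreover note Bx[OF \<open>\<eta> > 0\<close>]
      moreover have "\<forall>\<^sub>F \<delta>::real in at_right 0. 0 < \<delta>" by (rule eventually_at_right_less)
      ultimately show "\<forall>\<^sub>F \<delta> in at_right 0. \<forall>y. norm (y - A x) \<le> \<delta> \<longrightarrow>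
          norm (T x - R (\<gamma>s \<delta> y) y) \<le> \<epsilon>"
      proof eventually_elim
        case (elim \<delta>)
        show ?case
        proof (intro allI impI)
          fix y assume y: "norm (y - A x) \<le> \<delta>"
          let ?b = "B (\<alpha>s \<delta> y) y" and ?D = "D (\<theta>s \<delta> y) (\<beta>s \<delta> y)"
          have b: "norm (x - ?b) \<le> \<eta>" using elim y by blast
          have "norm (?D x - ?D ?b) \<le> L * norm (x - ?b)"
            using b \<open>\<eta> \<le> 1\<close> elim \<beta>s \<theta>s
            by (intro lipschitz_on_normD[OF L]) (auto simp: dist_norm)
          also have "\<dots> \<le> (\<bar>L\<bar> + 1) * \<eta>"
            using b by (intro mult_mono) auto
          also note L\<eta>
          finally have "norm (?D x - ?D ?b) \<le> \<epsilon> / 2" .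
          moreover have "norm (T x - ?D x) \<le> \<epsilon> / 2" using elim y by blast
          ultimately have "norm (T x - ?D ?b) \<le> \<epsilon>"
            using norm_triangle_ineq[of "T x - ?D x" "?D x - ?D ?b"] by simp
          then show "norm (T x - R (\<gamma>s \<delta> y) y) \<le> \<epsilon>" by (simp add: R \<gamma>s)
        qed
      qed
    qed
    then show "((\<lambda>\<delta>. SUP y\<in>{y. norm (y - A x') \<le> \<delta>}. ereal (norm (x' - R (\<gamma>s \<delta> y) y))) \<longlongrightarrow> 0) (at_right 0)"
      by (simp add: x AT)
  qed
  moreover have "rate_data_proximal r A (T ` M) \<Gamma> R \<gamma>s"
    if r: "0 < r \<and> r \<le> 1"
      and O: "(\<lambda>(\<delta>, y). \<beta>s \<delta> y) \<in> O[principal (noisy_data A M)](\<lambda>(\<delta>, y). \<delta> powr r)"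
      and prox: "rate_data_proximal r A M {0<..} B \<alpha>s" for r
  proof -
    obtain C where "C > 0" and ev: "\<forall>\<^sub>F p in principal (noisy_data A M).
        norm (case p of (\<delta>, y) \<Rightarrow> \<beta>s \<delta> y) \<le> C * norm (case p of (\<delta>, y) \<Rightarrow> \<delta> powr r)"
      by (rule landau_o.bigE[OF O])
    \<comment> \<open>Along a principal filter, eventually means everywhere on the set, so
      \<open>C\<close> serves all noise levels.\<close>
    have C: "\<beta>s \<delta> y \<le> C * \<delta> powr r" if "(\<delta>, y) \<in> noisy_data A M" for \<delta> y
      using bspec[OF ev[unfolded eventually_principal] that] by simp
    have "norm (A (R (\<gamma>s \<delta> y) y) - A (B (\<alpha>s \<delta> y) y)) \<le> C * \<delta> powr r"
      if "x \<in> M" "\<delta> \<in> {0<..}" "norm (y - A x) \<le> \<delta>" for x \<delta> y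
    proof -
      have "(\<delta>, y) \<in> noisy_data A M" using that by (auto simp: noisy_data_def)
      with C AD[of \<delta> y] that show ?thesis by fastforce
    qed
    moreover have "data_proximity_estimate {0<..} r A M B \<alpha>s"
      using prox by (simp add: rate_data_proximal_def)
    ultimately have "data_proximity_estimate {0<..} r A (T ` M) R \<gamma>s"
      using data_proximity_estimate_perturb[where A = A and T = T, OF _ \<open>C > 0\<close> AT] by blast
    with r reg show ?thesis by (simp add: rate_data_proximal_def)
  qed
  moreover have "asymptotically_rate_data_proximal r A (T ` M) \<Gamma> R \<gamma>s"
    if r: "0 < r \<and> r \<le> 1"
      and O: "(\<lambda>(\<delta>, y). \<beta>s \<delta> y) \<in> O[vanishing_noise A M](\<lambda>(\<delta>, y). \<delta> powr r)"
      and prox: "asymptotically_rate_data_proximal r A M {0<..} B \<alpha>s" for r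
  proof -
    obtain \<delta>\<^sub>0 where "\<delta>\<^sub>0 > 0" and \<delta>\<^sub>0: "data_proximity_estimate {0<..<\<delta>\<^sub>0} r A M B \<alpha>s"
      using prox unfolding asymptotically_rate_data_proximal_def by blast
    obtain C where "C > 0" and ev: "\<forall>\<^sub>F p in vanishing_noise A M.
        norm (case p of (\<delta>, y) \<Rightarrow> \<beta>s \<delta> y) \<le> C * norm (case p of (\<delta>, y) \<Rightarrow> \<delta> powr r)"
      by (rule landau_o.bigE[OF O])
    \<comment> \<open>\<open>Q\<close> restricts only the noise level, so the bound is uniform over
      the noisy data at each small level.\<close>
    obtain Q where Q: "eventually Q (at_right 0)"
      and QC: "\<And>p. Q (fst p) \<Longrightarrow> p \<in> noisy_data A M \<Longrightarrow>
        norm (case p of (\<delta>, y) \<Rightarrow> \<beta>s \<delta> y) \<le> C * norm (case p of (\<delta>, y) \<Rightarrow> \<delta> powr r)"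
      using ev unfolding vanishing_noise_def eventually_inf_principal eventually_filtercomap by blast
    obtain \<delta>\<^sub>1 where "\<delta>\<^sub>1 > 0" and \<delta>\<^sub>1: "\<And>\<delta>. 0 < \<delta> \<Longrightarrow> \<delta> < \<delta>\<^sub>1 \<Longrightarrow> Q \<delta>"
      using Q unfolding eventually_at_right_field by blast
    \<comment> \<open>Below \<open>\<delta>\<^sub>0\<close> the estimate for \<open>B\<close> is
      available, below \<open>\<delta>\<^sub>1\<close> the bound on \<open>\<beta>s\<close>.\<close>
    have "norm (A (R (\<gamma>s \<delta> y) y) - A (B (\<alpha>s \<delta> y) y)) \<le> C * \<delta> powr r"
      if "x \<in> M" "\<delta> \<in> {0<..<min \<delta>\<^sub>0 \<delta>\<^sub>1}" "norm (y - A x) \<le> \<delta>" for x \<delta> y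
    proof -
      have "(\<delta>, y) \<in> noisy_data A M" using that by (auto simp: noisy_data_def)
      then have "\<beta>s \<delta> y \<le> C * \<delta> powr r"
        using QC[of "(\<delta>, y)"] \<delta>\<^sub>1 that by simp
      with AD[of \<delta> y] that show ?thesis by simp
    qed
    moreover have "{0<..<min \<delta>\<^sub>0 \<delta>\<^sub>1} \<subseteq> {0<..<\<delta>\<^sub>0}" by auto
    ultimately have "data_proximity_estimate {0<..<min \<delta>\<^sub>0 \<delta>\<^sub>1} r A (T ` M) R \<gamma>s"
      using data_proximity_estimate_perturb[where A = A and T = T, OF \<delta>\<^sub>0 \<open>C > 0\<close> AT] by blast
    moreover have "min \<delta>\<^sub>0 \<delta>\<^sub>1 > 0" using \<open>\<delta>\<^sub>0 > 0\<close> \<open>\<delta>\<^sub>1 > 0\<close> by simp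
    ultimately show ?thesis
      using r reg unfolding asymptotically_rate_data_proximal_def by blast
  qed
  ultimately show ?thesis by blast
qed

end
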